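(* Let $R$ be a commutative ring with identity and let $S$ be a multiplicative subset of $R$ such that every element of $S$ is regular. The following assertions are equivalent: 1. For every finitely generated ideal $I$ of $R$, $\mathrm{Sat}_S(I)$ is c-$S$-finitely presented. 2. $R$ is c-$S$-coherent and, for every finitely generated ideal $I$ of $R$, $\mathrm{Sat}_S(I)=(I:s)$ for some $s\in S$.
   Context: All rings are commutative with identity and all modules are unitary. A multiplicative subset of $R$ is a subset containing $1$ and closed under multiplication. An element of $R$ is regular if it is not a zero-divisor of $R$. For an ideal $I$ and $s\in R$, $(I:s)=\{x\in R : xs\in I\}$. For an ideal $I$ of $R$, the $S$-saturation is $\mathrm{Sat}_S(I):=IR_S\cap R$, i.e. the preimage of the ideal $IR_S$ under the canonical map $R\to R_S$. An $R$-module $M$ is $S$-finite if there exist a finitely generated submodule $N$ of $M$ and $s\in S$ such that $sM\subseteq N$. An $R$-module $M$ is c-$S$-finitely presented if there exist a finitely presented submodule $N$ of $M$ and $s\in S$ such that $sM\subseteq N\subseteq M$. The ring $R$ is c-$S$-coherent if every $S$-finite ideal of $R$ is c-$S$-finitely presented. *)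

theory Defs
  imports "HOL-Algebra.QuotRing" "HOL-Algebra.Module" "HOL-Algebra.Ring_Divisibility"
begin

definition regular_elt :: "('a, 'm) ring_scheme \<Rightarrow> 'a \<Rightarrow> bool" where
  "regular_elt R x \<longleftrightarrow>
     x \<in> carrier R \<and> (\<forall>y \<in> carrier R. x \<otimes>\<^bsub>R\<^esub> y = \<zero>\<^bsub>R\<^esub> \<longrightarrow> y = \<zero>\<^bsub>R\<^esub>)"

text \<open>The same notion of finitely generated ideal as in \<^locale>\<open>noetherian_ring\<close>.\<close>

definition fg_ideal :: "('a, 'm) ring_scheme \<Rightarrow> 'a set \<Rightarrow> bool" where
  "fg_ideal R I \<longleftrightarrow> (\<exists>A \<subseteq> carrier R. finite A \<and> I = Idl\<^bsub>R\<^esub> A)"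

definition ideal_colon :: "('a, 'm) ring_scheme \<Rightarrow> 'a set \<Rightarrow> 'a \<Rightarrow> 'a set" where
  "ideal_colon R I s = {x \<in> carrier R. x \<otimes>\<^bsub>R\<^esub> s \<in> I}"


section \<open>Localization and saturation\<close>

text \<open>No regularity is built into the construction: two fractions \<open>a/s\<close> and \<open>b/t\<close> are
  identified when \<open>u (a t - b s) = 0\<close> for some \<open>u\<close> in \<open>S\<close>. An element of the localization is an
  equivalence class of pairs (numerator, denominator).\<close>

definition frac_rel :: "('a, 'm) ring_scheme \<Rightarrow> 'a set \<Rightarrow> (('a \<times> 'a) \<times> ('a \<times> 'a)) set" where
  "frac_rel R S =
     {((a, s), (b, t)). a \<in> carrier R \<and> s \<in> S \<and> b \<in> carrier R \<and> t \<in> S \<and>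
        (\<exists>u \<in> S. u \<otimes>\<^bsub>R\<^esub> (a \<otimes>\<^bsub>R\<^esub> t \<ominus>\<^bsub>R\<^esub> b \<otimes>\<^bsub>R\<^esub> s) = \<zero>\<^bsub>R\<^esub>)}"

definition fraction :: "('a, 'm) ring_scheme \<Rightarrow> 'a set \<Rightarrow> 'a \<Rightarrow> 'a \<Rightarrow> ('a \<times> 'a) set" where
  "fraction R S a s = frac_rel R S `` {(a, s)}"

text \<open>The unions below range over all representatives; since the operations respect
  \<^const>\<open>frac_rel\<close>, all the classes united are equal (see \<open>localization_mult_frac\<close> and
  \<open>localization_add_frac\<close>).\<close>

definition localization :: "('a, 'm) ring_scheme \<Rightarrow> 'a set \<Rightarrow> ('a \<times> 'a) set ring" where
  "localization R S =
     \<lparr>carrier = (carrier R \<times> S) // frac_rel R S,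
      mult = (\<lambda>P Q. \<Union>(a, s) \<in> P. \<Union>(b, t) \<in> Q. fraction R S (a \<otimes>\<^bsub>R\<^esub> b) (s \<otimes>\<^bsub>R\<^esub> t)),
      one = fraction R S \<one>\<^bsub>R\<^esub> \<one>\<^bsub>R\<^esub>,
      zero = fraction R S \<zero>\<^bsub>R\<^esub> \<one>\<^bsub>R\<^esub>,
      add = (\<lambda>P Q. \<Union>(a, s) \<in> P. \<Union>(b, t) \<in> Q.
               fraction R S (a \<otimes>\<^bsub>R\<^esub> t \<oplus>\<^bsub>R\<^esub> b \<otimes>\<^bsub>R\<^esub> s) (s \<otimes>\<^bsub>R\<^esub> t))\<rparr>"

definition localization_map :: "('a, 'm) ring_scheme \<Rightarrow> 'a set \<Rightarrow> 'a \<Rightarrow> ('a \<times> 'a) set" where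
  "localization_map R S a = fraction R S a \<one>\<^bsub>R\<^esub>"

definition Sat :: "('a, 'm) ring_scheme \<Rightarrow> 'a set \<Rightarrow> 'a set \<Rightarrow> 'a set" where
  "Sat R S I =
     {x \<in> carrier R. localization_map R S x \<in>
        Idl\<^bsub>localization R S\<^esub> (localization_map R S ` I)}"


section \<open>Finiteness conditions on modules\<close>

text \<open>The ring multiplication serves as scalar multiplication; the fields \<open>mult\<close> and \<open>one\<close> are
  irrelevant for the module structure.\<close>

definition ideal_module :: "('a, 'm) ring_scheme \<Rightarrow> 'a set \<Rightarrow> ('a, 'a) module" where
  "ideal_module R I =
     \<lparr>carrier = I, mult = (\<otimes>\<^bsub>R\<^esub>), one = \<one>\<^bsub>R\<^esub>, zero = \<zero>\<^bsub>R\<^esub>, add = (\<oplus>\<^bsub>R\<^esub>),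
      smult = (\<otimes>\<^bsub>R\<^esub>)\<rparr>"

text \<open>The free module \<open>R\<^sup>n\<close>, with vectors as functions that are \<^term>\<open>undefined\<close> outside
  \<open>{..<n}\<close>. Again \<open>mult\<close> and \<open>one\<close> are irrelevant.\<close>

definition free_module :: "('a, 'm) ring_scheme \<Rightarrow> nat \<Rightarrow> ('a, nat \<Rightarrow> 'a) module" where
  "free_module R n =
     \<lparr>carrier = {..<n} \<rightarrow>\<^sub>E carrier R,
      mult = (\<lambda>v w. \<lambda>i\<in>{..<n}. v i \<otimes>\<^bsub>R\<^esub> w i),
      one = (\<lambda>i\<in>{..<n}. \<one>\<^bsub>R\<^esub>),
      zero = (\<lambda>i\<in>{..<n}. \<zero>\<^bsub>R\<^esub>),
      add = (\<lambda>v w. \<lambda>i\<in>{..<n}. v i \<oplus>\<^bsub>R\<^esub> w i),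
      smult = (\<lambda>r v. \<lambda>i\<in>{..<n}. r \<otimes>\<^bsub>R\<^esub> v i)\<rparr>"

definition module_hom ::
  "('a, 'm) ring_scheme \<Rightarrow> ('a, 'b, 'k) module_scheme \<Rightarrow> ('a, 'c, 'l) module_scheme \<Rightarrow> ('b \<Rightarrow> 'c) set"
  where
  "module_hom R M N =
     {h \<in> hom (add_monoid M) (add_monoid N).
        \<forall>r \<in> carrier R. \<forall>x \<in> carrier M. h (r \<odot>\<^bsub>M\<^esub> x) = r \<odot>\<^bsub>N\<^esub> h x}"

definition module_span ::
  "('a, 'm) ring_scheme \<Rightarrow> ('a, 'b, 'k) module_scheme \<Rightarrow> 'b set \<Rightarrow> 'b set" where
  "module_span R M A = \<Inter>{N. submodule N R M \<and> A \<subseteq> N}"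

definition finitely_generated ::
  "('a, 'm) ring_scheme \<Rightarrow> ('a, 'b, 'k) module_scheme \<Rightarrow> bool" where
  "finitely_generated R M \<longleftrightarrow>
     (\<exists>A \<subseteq> carrier M. finite A \<and> carrier M = module_span R M A)"

text \<open>There is an exact sequence \<open>0 \<rightarrow> K \<rightarrow> R\<^sup>n \<rightarrow> M \<rightarrow> 0\<close> with \<open>K\<close> finitely generated.\<close>

definition finitely_presented ::
  "('a, 'm) ring_scheme \<Rightarrow> ('a, 'b, 'k) module_scheme \<Rightarrow> bool" where
  "finitely_presented R M \<longleftrightarrow>
     (\<exists>n. \<exists>h \<in> module_hom R (free_module R n) M.
        h ` carrier (free_module R n) = carrier M \<and>
        finitely_generated R
          ((free_module R n)\<lparr>carrier := a_kernel (free_module R n) M h\<rparr>))"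

definition S_finite ::
  "('a, 'm) ring_scheme \<Rightarrow> 'a set \<Rightarrow> ('a, 'b, 'k) module_scheme \<Rightarrow> bool" where
  "S_finite R S M \<longleftrightarrow>
     (\<exists>N. \<exists>s \<in> S. submodule N R M \<and> finitely_generated R (M\<lparr>carrier := N\<rparr>) \<and>
        (\<lambda>x. s \<odot>\<^bsub>M\<^esub> x) ` carrier M \<subseteq> N)"

definition c_S_finitely_presented ::
  "('a, 'm) ring_scheme \<Rightarrow> 'a set \<Rightarrow> ('a, 'b, 'k) module_scheme \<Rightarrow> bool" where
  "c_S_finitely_presented R S M \<longleftrightarrow>
     (\<exists>N. \<exists>s \<in> S. submodule N R M \<and> finitely_presented R (M\<lparr>carrier := N\<rparr>) \<and>
        (\<lambda>x. s \<odot>\<^bsub>M\<^esub> x) ` carrier M \<subseteq> N)"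

definition c_S_coherent :: "('a, 'm) ring_scheme \<Rightarrow> 'a set \<Rightarrow> bool" where
  "c_S_coherent R S \<longleftrightarrow>
     (\<forall>I. ideal I R \<and> S_finite R S (ideal_module R I) \<longrightarrow>
        c_S_finitely_presented R S (ideal_module R I))"


section \<open>Well-definedness of the constructions\<close>

lemma ideal_module_module:
  assumes "cring R" and "ideal I R"
  shows "module R (ideal_module R I)"
proof -
  interpret R: cring R by fact
  interpret I: ideal I R by fact
  have inv: "\<exists>y\<in>I. y \<oplus>\<^bsub>R\<^esub> x = \<zero>\<^bsub>R\<^esub>" if "x \<in> I" for x
    using that by (intro bexI[of _ "\<ominus>\<^bsub>R\<^esub> x"]) (simp_all add: R.l_neg)
  have "abelian_group (ideal_module R I)"
    by (rule abelian_groupI) (simp_all add: ideal_module_def inv R.a_assoc, simp add: R.a_comm)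
  then show ?thesis
    by (rule moduleI[OF \<open>cring R\<close>])
       (simp_all add: ideal_module_def R.m_assoc R.l_distr R.r_distr I.I_l_closed)
qed

lemma free_module_module:
  assumes "cring R"
  shows "module R (free_module R n)"
proof -
  interpret R: cring R by fact
  have mem: "x i \<in> carrier R" if "x \<in> {..<n} \<rightarrow>\<^sub>E carrier R" "i < n" for x :: "nat \<Rightarrow> 'a" and i
    using that by auto
  have inv: "\<exists>y\<in>{..<n} \<rightarrow>\<^sub>E carrier R. (\<lambda>i\<in>{..<n}. y i \<oplus>\<^bsub>R\<^esub> x i) = (\<lambda>i\<in>{..<n}. \<zero>\<^bsub>R\<^esub>)"
    if "x \<in> {..<n} \<rightarrow>\<^sub>E carrier R" for x
    using mem[OF that]
    by (intro bexI[of _ "\<lambda>i\<in>{..<n}. \<ominus>\<^bsub>R\<^esub> x i"]) (auto intro!: restrict_ext R.l_neg)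
  have ext: "restrict f {..<n} = x" if "x \<in> {..<n} \<rightarrow>\<^sub>E carrier R" "\<And>i. i < n \<Longrightarrow> f i = x i"
    for f and x :: "nat \<Rightarrow> 'a"
    using that by (auto simp: fun_eq_iff PiE_iff extensional_def)
  have "abelian_group (free_module R n)"
  proof (rule abelian_groupI)
    show "x \<oplus>\<^bsub>free_module R n\<^esub> y = y \<oplus>\<^bsub>free_module R n\<^esub> x"
      if "x \<in> carrier (free_module R n)" "y \<in> carrier (free_module R n)" for x y
      using that by (auto simp: free_module_def mem intro!: restrict_ext R.a_comm)
  qed (simp_all add: free_module_def inv mem ext R.a_assoc cong: restrict_cong)
  then show ?thesis
    by (rule moduleI[OF \<open>cring R\<close>])
       (simp_all add: free_module_def mem ext R.m_assoc R.l_distr R.r_distr cong: restrict_cong)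
qed

context
  fixes R :: "('a, 'm) ring_scheme" (structure) and S :: "'a set"
  assumes cring: "cring R" and mult_set: "submonoid S R"
begin

interpretation R: cring R by (rule cring)
interpretation S: submonoid S R by (rule mult_set)

lemma mult_set_closed: "s \<in> S \<Longrightarrow> s \<in> carrier R" by simp

lemma frac_rel_iff:
  "((a, s), (b, t)) \<in> frac_rel R S \<longleftrightarrow>
     a \<in> carrier R \<and> s \<in> S \<and> b \<in> carrier R \<and> t \<in> S \<and> (\<exists>u \<in> S. u \<otimes> a \<otimes> t = u \<otimes> b \<otimes> s)"
proof -
  have "u \<otimes> (a \<otimes> t \<ominus> b \<otimes> s) = \<zero> \<longleftrightarrow> u \<otimes> a \<otimes> t = u \<otimes> b \<otimes> s"
    if "a \<in> carrier R" "s \<in> S" "b \<in> carrier R" "t \<in> S" "u \<in> S" for u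
  proof -
    have "u \<otimes> (a \<otimes> t \<ominus> b \<otimes> s) = u \<otimes> a \<otimes> t \<ominus> u \<otimes> b \<otimes> s"
      using that by (simp add: R.minus_eq R.r_distr R.r_minus R.m_assoc)
    then show ?thesis using that by (simp add: R.r_right_minus_eq)
  qed
  then show ?thesis unfolding frac_rel_def by auto
qed

lemma equiv_frac_rel: "equiv (carrier R \<times> S) (frac_rel R S)"
proof (rule equivI)
  show "frac_rel R S \<subseteq> (carrier R \<times> S) \<times> (carrier R \<times> S)"
    unfolding frac_rel_def by auto
  show "refl_on (carrier R \<times> S) (frac_rel R S)"
    by (auto simp: refl_on_def frac_rel_iff intro: S.one_closed)
  show "sym (frac_rel R S)"
    by (auto simp: sym_def frac_rel_iff) metis
  show "trans (frac_rel R S)"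
  proof (rule transI, clarify)
    fix a s b t c v
    assume "((a, s), (b, t)) \<in> frac_rel R S" "((b, t), (c, v)) \<in> frac_rel R S"
    then obtain u w where *: "a \<in> carrier R" "s \<in> S" "b \<in> carrier R" "t \<in> S" "c \<in> carrier R"
      "v \<in> S" "u \<in> S" "w \<in> S" "u \<otimes> a \<otimes> t = u \<otimes> b \<otimes> s" "w \<otimes> b \<otimes> v = w \<otimes> c \<otimes> t"
      by (auto simp: frac_rel_iff)
    note c = *(1-8) *(2,4,6-8)[THEN mult_set_closed]
    have "(u \<otimes> w \<otimes> t) \<otimes> a \<otimes> v = (u \<otimes> a \<otimes> t) \<otimes> (w \<otimes> v)"
      using c by (simp add: R.m_ac)
    also have "\<dots> = (w \<otimes> b \<otimes> v) \<otimes> (u \<otimes> s)"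
      unfolding *(9) using c by (simp add: R.m_ac)
    also have "\<dots> = (u \<otimes> w \<otimes> t) \<otimes> c \<otimes> s"
      unfolding *(10) using c by (simp add: R.m_ac)
    finally show "((a, s), (c, v)) \<in> frac_rel R S"
      using * by (auto simp: frac_rel_iff intro!: bexI[of _ "u \<otimes> w \<otimes> t"])
  qed
qed

lemma frac_eq_iff:
  assumes "a \<in> carrier R" "s \<in> S" "b \<in> carrier R" "t \<in> S"
  shows "fraction R S a s = fraction R S b t \<longleftrightarrow> (\<exists>u \<in> S. u \<otimes> a \<otimes> t = u \<otimes> b \<otimes> s)"
  unfolding fraction_def using assms
  by (subst eq_equiv_class_iff[OF equiv_frac_rel]) (auto simp: frac_rel_iff)

lemma frac_mult_cong:
  assumes "((a, s), (a', s')) \<in> frac_rel R S" "((b, t), (b', t')) \<in> frac_rel R S"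
  shows "fraction R S (a \<otimes> b) (s \<otimes> t) = fraction R S (a' \<otimes> b') (s' \<otimes> t')"
proof -
  from assms obtain u w where *: "a \<in> carrier R" "s \<in> S" "a' \<in> carrier R" "s' \<in> S"
    "b \<in> carrier R" "t \<in> S" "b' \<in> carrier R" "t' \<in> S" "u \<in> S" "w \<in> S"
    "u \<otimes> a \<otimes> s' = u \<otimes> a' \<otimes> s" "w \<otimes> b \<otimes> t' = w \<otimes> b' \<otimes> t"
    by (auto simp: frac_rel_iff)
  note c = *(1-10) *(2,4,6,8-10)[THEN mult_set_closed]
  have "(u \<otimes> w) \<otimes> (a \<otimes> b) \<otimes> (s' \<otimes> t') = (u \<otimes> a \<otimes> s') \<otimes> (w \<otimes> b \<otimes> t')"
    using c by (simp add: R.m_ac)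
  also have "\<dots> = (u \<otimes> w) \<otimes> (a' \<otimes> b') \<otimes> (s \<otimes> t)"
    unfolding *(11,12) using c by (simp add: R.m_ac)
  finally show ?thesis
    using c by (subst frac_eq_iff) (auto intro!: bexI[of _ "u \<otimes> w"])
qed

lemma frac_add_cong:
  assumes "((a, s), (a', s')) \<in> frac_rel R S" "((b, t), (b', t')) \<in> frac_rel R S"
  shows "fraction R S (a \<otimes> t \<oplus> b \<otimes> s) (s \<otimes> t) = fraction R S (a' \<otimes> t' \<oplus> b' \<otimes> s') (s' \<otimes> t')"
proof -
  from assms obtain u w where *: "a \<in> carrier R" "s \<in> S" "a' \<in> carrier R" "s' \<in> S"
    "b \<in> carrier R" "t \<in> S" "b' \<in> carrier R" "t' \<in> S" "u \<in> S" "w \<in> S"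
    "u \<otimes> a \<otimes> s' = u \<otimes> a' \<otimes> s" "w \<otimes> b \<otimes> t' = w \<otimes> b' \<otimes> t"
    by (auto simp: frac_rel_iff)
  note c = *(1-10) *(2,4,6,8-10)[THEN mult_set_closed]
  have "(u \<otimes> w) \<otimes> (a \<otimes> t \<oplus> b \<otimes> s) \<otimes> (s' \<otimes> t') =
      (u \<otimes> a \<otimes> s') \<otimes> (w \<otimes> t \<otimes> t') \<oplus> (w \<otimes> b \<otimes> t') \<otimes> (u \<otimes> s \<otimes> s')"
    using c by (simp add: R.m_ac R.l_distr R.r_distr)
  also have "\<dots> = (u \<otimes> w) \<otimes> (a' \<otimes> t' \<oplus> b' \<otimes> s') \<otimes> (s \<otimes> t)"
    unfolding *(11,12) using c by (simp add: R.m_ac R.l_distr R.r_distr)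
  finally show ?thesis
    using c by (subst frac_eq_iff) (auto intro!: bexI[of _ "u \<otimes> w"])
qed

lemma UN_frac:
  assumes "a \<in> carrier R" "s \<in> S" "b \<in> carrier R" "t \<in> S"
    and "\<And>a s a' s' b t b' t'. ((a, s), (a', s')) \<in> frac_rel R S \<Longrightarrow>
      ((b, t), (b', t')) \<in> frac_rel R S \<Longrightarrow> f a s b t = f a' s' b' t'"
  shows "(\<Union>(a, s) \<in> fraction R S a s. \<Union>(b, t) \<in> fraction R S b t. f a s b t) = f a s b t"
proof -
  have "(a, s) \<in> fraction R S a s" "(b, t) \<in> fraction R S b t"
    using assms(1-4) by (auto simp: fraction_def frac_rel_iff)
  moreover have "f a' s' b' t' = f a s b t"
    if "(a', s') \<in> fraction R S a s" "(b', t') \<in> fraction R S b t" for a' s' b' t'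
    using assms(5)[of a s a' s' b t b' t'] that by (simp add: fraction_def)
  ultimately show ?thesis by fast
qed

lemma localization_mult_frac:
  assumes "a \<in> carrier R" "s \<in> S" "b \<in> carrier R" "t \<in> S"
  shows "fraction R S a s \<otimes>\<^bsub>localization R S\<^esub> fraction R S b t = fraction R S (a \<otimes> b) (s \<otimes> t)"
  using UN_frac[OF assms frac_mult_cong] by (simp add: localization_def)

lemma localization_add_frac:
  assumes "a \<in> carrier R" "s \<in> S" "b \<in> carrier R" "t \<in> S"
  shows "fraction R S a s \<oplus>\<^bsub>localization R S\<^esub> fraction R S b t = fraction R S (a \<otimes> t \<oplus> b \<otimes> s) (s \<otimes> t)"
  using UN_frac[OF assms frac_add_cong] by (simp add: localization_def)

lemma localization_carrier:
  "carrier (localization R S) = {fraction R S a s |a s. a \<in> carrier R \<and> s \<in> S}"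
  by (auto simp: localization_def quotient_def fraction_def)

lemma frac_eqI:
  assumes "a \<in> carrier R" "s \<in> S" "b \<in> carrier R" "t \<in> S" "a \<otimes> t = b \<otimes> s"
  shows "fraction R S a s = fraction R S b t"
  using assms by (subst frac_eq_iff) (auto intro!: bexI[of _ \<one>])

lemma localization_ops:
  "\<one>\<^bsub>localization R S\<^esub> = fraction R S \<one> \<one>"
  "\<zero>\<^bsub>localization R S\<^esub> = fraction R S \<zero> \<one>"
  by (simp_all add: localization_def)

lemma fraction_closed:
  "a \<in> carrier R \<Longrightarrow> s \<in> S \<Longrightarrow> fraction R S a s \<in> carrier (localization R S)"
  by (auto simp: localization_carrier)

lemma localization_cases:
  assumes "x \<in> carrier (localization R S)"
  obtains a s where "x = fraction R S a s" "a \<in> carrier R" "s \<in> S" "s \<in> carrier R"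
  using assms by (auto simp: localization_carrier)

lemma localization_cring: "cring (localization R S)"
proof -
  let ?L = "localization R S"
  note ops = localization_ops localization_mult_frac localization_add_frac fraction_closed
  have grp: "abelian_group ?L"
  proof (rule abelian_groupI)
    fix x y z assume "x \<in> carrier ?L" "y \<in> carrier ?L" "z \<in> carrier ?L"
    then obtain a s b t c u where
      *: "x = fraction R S a s" "a \<in> carrier R" "s \<in> S" "s \<in> carrier R"
         "y = fraction R S b t" "b \<in> carrier R" "t \<in> S" "t \<in> carrier R"
         "z = fraction R S c u" "c \<in> carrier R" "u \<in> S" "u \<in> carrier R"
      by (elim localization_cases)
    show "x \<oplus>\<^bsub>?L\<^esub> y \<in> carrier ?L" using * by (simp add: ops)
    show "x \<oplus>\<^bsub>?L\<^esub> y \<oplus>\<^bsub>?L\<^esub> z = x \<oplus>\<^bsub>?L\<^esub> (y \<oplus>\<^bsub>?L\<^esub> z)"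
      proof -
      have "(a \<otimes> t \<oplus> b \<otimes> s) \<otimes> u \<oplus> c \<otimes> (s \<otimes> t) = a \<otimes> (t \<otimes> u) \<oplus> (b \<otimes> u \<oplus> c \<otimes> t) \<otimes> s"
        using *(2,4,6,8,10,12) by (simp add: R.l_distr R.a_assoc) (simp add: R.m_ac)
      then show ?thesis using * by (simp add: ops R.m_assoc)
    qed
    show "x \<oplus>\<^bsub>?L\<^esub> y = y \<oplus>\<^bsub>?L\<^esub> x"
      using * by (simp add: ops R.m_comm R.a_comm)
  next
    fix x assume "x \<in> carrier ?L"
    then obtain a s where *: "x = fraction R S a s" "a \<in> carrier R" "s \<in> S" "s \<in> carrier R"
      by (elim localization_cases)
    show "\<zero>\<^bsub>?L\<^esub> \<oplus>\<^bsub>?L\<^esub> x = x" using * by (simp add: ops)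
    have "fraction R S (\<ominus> a \<otimes> s \<oplus> a \<otimes> s) (s \<otimes> s) = fraction R S \<zero> \<one>"
      using * by (intro frac_eqI) (simp_all add: R.l_minus R.l_neg)
    then show "\<exists>y \<in> carrier ?L. y \<oplus>\<^bsub>?L\<^esub> x = \<zero>\<^bsub>?L\<^esub>"
      using * by (intro bexI[of _ "fraction R S (\<ominus> a) s"]) (simp_all add: ops)
  qed (simp add: ops)
  have mon: "comm_monoid ?L"
  proof (rule comm_monoidI)
    fix x y z assume "x \<in> carrier ?L" "y \<in> carrier ?L" "z \<in> carrier ?L"
    then obtain a s b t c u where
      *: "x = fraction R S a s" "a \<in> carrier R" "s \<in> S" "s \<in> carrier R"
         "y = fraction R S b t" "b \<in> carrier R" "t \<in> S" "t \<in> carrier R"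
         "z = fraction R S c u" "c \<in> carrier R" "u \<in> S" "u \<in> carrier R"
      by (elim localization_cases)
    show "x \<otimes>\<^bsub>?L\<^esub> y \<in> carrier ?L" using * by (simp add: ops)
    show "x \<otimes>\<^bsub>?L\<^esub> y \<otimes>\<^bsub>?L\<^esub> z = x \<otimes>\<^bsub>?L\<^esub> (y \<otimes>\<^bsub>?L\<^esub> z)"
      using * by (simp add: ops R.m_assoc)
    show "x \<otimes>\<^bsub>?L\<^esub> y = y \<otimes>\<^bsub>?L\<^esub> x"
      using * by (simp add: ops R.m_comm)
  next
    fix x assume "x \<in> carrier ?L"
    then show "\<one>\<^bsub>?L\<^esub> \<otimes>\<^bsub>?L\<^esub> x = x"
      by (elim localization_cases) (simp add: ops)
  qed (simp add: ops)
  have distr: "(x \<oplus>\<^bsub>?L\<^esub> y) \<otimes>\<^bsub>?L\<^esub> z = x \<otimes>\<^bsub>?L\<^esub> z \<oplus>\<^bsub>?L\<^esub> y \<otimes>\<^bsub>?L\<^esub> z"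
    if xyz: "x \<in> carrier ?L" "y \<in> carrier ?L" "z \<in> carrier ?L" for x y z
  proof -
    from xyz obtain a s b t c u where
      *: "x = fraction R S a s" "a \<in> carrier R" "s \<in> S" "s \<in> carrier R"
         "y = fraction R S b t" "b \<in> carrier R" "t \<in> S" "t \<in> carrier R"
         "z = fraction R S c u" "c \<in> carrier R" "u \<in> S" "u \<in> carrier R"
      by (elim localization_cases)
    have "fraction R S ((a \<otimes> t \<oplus> b \<otimes> s) \<otimes> c) (s \<otimes> t \<otimes> u) =
        fraction R S ((a \<otimes> c) \<otimes> (t \<otimes> u) \<oplus> (b \<otimes> c) \<otimes> (s \<otimes> u)) ((s \<otimes> u) \<otimes> (t \<otimes> u))"
      using *
      by (intro frac_eqI) (simp_all add: R.l_distr, simp add: R.m_ac)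
    then show ?thesis using * by (simp add: ops)
  qed
  show ?thesis by (rule cringI[OF grp mon distr])
qed

lemma localization_map_hom: "localization_map R S \<in> ring_hom R (localization R S)"
  by (rule ring_hom_memI)
     (simp_all add: localization_map_def localization_mult_frac localization_add_frac
        fraction_closed localization_ops)

end

end

theory Submission
  imports Defs
begin

text \<open>
  The saturation of \<open>I\<close> consists of the \<open>x\<close> with \<open>s x \<in> I\<close> for some \<open>s \<in> S\<close>. A finitely generated
  subideal \<open>N\<close> of it is therefore moved into \<open>I\<close> by a single \<open>t \<in> S\<close>, and since \<open>t\<close> is regular,
  \<open>t N\<close> is isomorphic to \<open>N\<close>. If \<open>s Sat(I) \<subseteq> N \<subseteq> Sat(I)\<close> with \<open>N\<close> finitely presented, then
  \<open>Sat(I) = (I : t s)\<close>; and for any ideal \<open>J\<close> between \<open>I\<close> and \<open>Sat(I)\<close>, the finitely presented ideal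
  \<open>t N\<close> witnesses that \<open>J\<close> is c-\<open>S\<close>-finitely presented. Conversely \<open>Sat(I) = (I : s)\<close> makes
  \<open>Sat(I)\<close> an \<open>S\<close>-finite ideal.
\<close>

section \<open>Ideals as modules over the ring\<close>

text \<open>Negation is multiplication by \<open>\<ominus> \<one>\<close>, and commutativity turns
  one-sided absorption into two-sided absorption.\<close>

lemma (in cring) ideal_of_closed:
  assumes "H \<subseteq> carrier R" "\<zero> \<in> H"
    and add: "\<And>x y. x \<in> H \<Longrightarrow> y \<in> H \<Longrightarrow> x \<oplus> y \<in> H"
    and mult: "\<And>r x. r \<in> carrier R \<Longrightarrow> x \<in> H \<Longrightarrow> r \<otimes> x \<in> H"
  shows "ideal H R"
proof (rule idealI)
  show "ring R" by (rule ring_axioms)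
  have "\<ominus> x \<in> H" if "x \<in> H" for x
  proof -
    have "x \<in> carrier R" using assms(1) that by blast
    then have "\<ominus> x = (\<ominus> \<one>) \<otimes> x" by (simp add: l_minus)
    then show ?thesis using mult[of "\<ominus> \<one>" x] that by simp
  qed
  then show "subgroup H (add_monoid R)"
    using assms by (intro add.subgroupI) (auto simp: a_inv_def)
  show "x \<otimes> a \<in> H" if "a \<in> H" "x \<in> carrier R" for a x using mult that by blast
  show "a \<otimes> x \<in> H" if "a \<in> H" "x \<in> carrier R" for a x
  proof -
    have "a \<otimes> x = x \<otimes> a" using that assms(1) by (intro m_comm) auto
    then show ?thesis using mult that by simp
  qed
qed

text \<open>The finiteness conditions form submodules by updating the carrier. No other field of
  \<open>ideal_module\<close> depends on the ideal, so the result is an \<open>ideal_module\<close>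
  again.\<close>

lemma ideal_module_carrier_update [simp]: "ideal_module R J\<lparr>carrier := N\<rparr> = ideal_module R N"
  by (simp add: ideal_module_def)

lemma ideal_module_simps [simp]:
  "carrier (ideal_module R J) = J"
  "zero (ideal_module R J) = zero R"
  "add (ideal_module R J) = add R"
  "smult (ideal_module R J) = mult R"
  by (simp_all add: ideal_module_def)

lemma (in cring) submodule_ideal_module_iff:
  assumes "ideal J R"
  shows "submodule N R (ideal_module R J) \<longleftrightarrow> ideal N R \<and> N \<subseteq> J"
proof
  have J: "J \<subseteq> carrier R" using assms by (simp add: ideal.Icarr subsetI)
  assume "submodule N R (ideal_module R J)"
  then interpret N: submodule N R "ideal_module R J" .
  have sub: "N \<subseteq> J" using N.subset by simp
  have "ideal N R"
    using sub J N.one_closed N.m_closed N.smult_closed by (intro ideal_of_closed) auto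
  with sub show "ideal N R \<and> N \<subseteq> J" by blast
next
  assume *: "ideal N R \<and> N \<subseteq> J"
  then interpret N: ideal N R by simp
  interpret M: module R "ideal_module R J"
    by (rule ideal_module_module[OF is_cring assms])
  show "submodule N R (ideal_module R J)"
  proof (rule M.submoduleI)
    show "\<ominus>\<^bsub>ideal_module R J\<^esub> a \<in> N" if "a \<in> N" for a
    proof -
      \<comment> \<open>The inverse in the module is defined relative to its own carrier; writing it
        as a scalar multiple brings it back to the operations of \<open>R\<close>.\<close>
      have "\<ominus>\<^bsub>ideal_module R J\<^esub> a = (\<ominus> \<one>) \<otimes> a"
        using M.smult_l_minus[of \<one> a] M.smult_one[of a] * that by auto
      then show ?thesis using that N.I_l_closed by simp
    qed
  qed (use * N.I_l_closed in auto)
qed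

text \<open>For generators in \<open>N\<close>, the submodules of \<open>N\<close> containing them
  are the ideals of \<open>R\<close> between the generators and \<open>N\<close>. The generated
  ideal is the least of these, so it equals the module span.\<close>

lemma (in cring) finitely_generated_ideal_module_iff:
  assumes "ideal N R"
  shows "finitely_generated R (ideal_module R N) \<longleftrightarrow> fg_ideal R N"
proof -
  have span: "module_span R (ideal_module R N) A = Idl A" if "A \<subseteq> N" for A
  proof -
    have A: "A \<subseteq> carrier R" using that assms by (meson additive_subgroup.a_subset ideal.axioms(1) order_trans)
    have "Idl A \<subseteq> N" using genideal_minimal[OF assms that] .
    then have "Idl A \<in> {K. submodule K R (ideal_module R N) \<and> A \<subseteq> K}"
      using genideal_ideal[OF A] genideal_self[OF A] by (simp add: submodule_ideal_module_iff[OF assms])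
    moreover have "Idl A \<subseteq> K" if "submodule K R (ideal_module R N) \<and> A \<subseteq> K" for K
      using that genideal_minimal submodule_ideal_module_iff[OF assms] by blast
    ultimately show ?thesis unfolding module_span_def by blast
  qed
  have sub: "N \<subseteq> carrier R" using assms by (simp add: ideal.Icarr subsetI)
  show ?thesis
    unfolding finitely_generated_def fg_ideal_def
    using span sub genideal_self by (metis ideal_module_simps(1) order_trans)
qed

section \<open>Elementwise description of the saturation\<close>

text \<open>Fractions with numerator in \<open>I\<close> form an ideal of the localization that
  contains the image of \<open>I\<close>. Hence an element \<open>x\<close> of the saturation
  satisfies \<open>x/1 = a/s\<close> with \<open>a\<close> in \<open>I\<close>, and clearing
  denominators gives a multiple of \<open>x\<close> in \<open>I\<close>.\<close>

lemma (in cring) Sat_eq: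
  assumes S: "submonoid S R" and I: "ideal I R"
  shows "Sat R S I = {x \<in> carrier R. \<exists>s \<in> S. s \<otimes> x \<in> I}"
proof -
  interpret S: submonoid S R by fact
  interpret I: ideal I R by fact
  let ?L = "localization R S"
  interpret L: cring ?L by (rule localization_cring[OF is_cring S])
  note ops = localization_ops[OF is_cring S] localization_mult_frac[OF is_cring S]
    localization_add_frac[OF is_cring S] fraction_closed[OF is_cring S]
  define H where "H = {fraction R S a s | a s. a \<in> I \<and> s \<in> S}"
  have HI: "fraction R S a s \<in> H" if "a \<in> I" "s \<in> S" for a s
    using that unfolding H_def by blast
  have "ideal H ?L"
  proof (rule L.ideal_of_closed)
    show "H \<subseteq> carrier ?L" unfolding H_def using ops by auto
    show "\<zero>\<^bsub>?L\<^esub> \<in> H" using HI[of \<zero> \<one>] by (simp add: ops)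
    show "x \<oplus>\<^bsub>?L\<^esub> y \<in> H" if "x \<in> H" "y \<in> H" for x y
    proof -
      from that obtain a s b t where "x = fraction R S a s" "a \<in> I" "s \<in> S"
        "y = fraction R S b t" "b \<in> I" "t \<in> S" unfolding H_def by blast
      then show ?thesis by (auto simp: ops I.I_r_closed intro!: HI)
    qed
    show "r \<otimes>\<^bsub>?L\<^esub> x \<in> H" if "r \<in> carrier ?L" "x \<in> H" for r x
    proof -
      from that obtain a s b t where "r = fraction R S b t" "b \<in> carrier R" "t \<in> S"
        "x = fraction R S a s" "a \<in> I" "s \<in> S"
        unfolding H_def by (auto simp: localization_carrier[OF is_cring S])
      then show ?thesis by (auto simp: ops I.I_l_closed intro!: HI)
    qed
  qed
  moreover have "localization_map R S ` I \<subseteq> H"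
    by (auto simp: localization_map_def intro!: HI)
  ultimately have sub: "Idl\<^bsub>?L\<^esub> (localization_map R S ` I) \<subseteq> H" by (rule L.genideal_minimal)
  have IL: "localization_map R S ` I \<subseteq> carrier ?L"
    by (auto simp: localization_map_def ops)
  interpret G: ideal "Idl\<^bsub>?L\<^esub> (localization_map R S ` I)" ?L
    by (rule L.genideal_ideal[OF IL])
  show ?thesis
  proof (intro equalityI subsetI)
    fix x assume "x \<in> Sat R S I"
    then have x: "x \<in> carrier R" "fraction R S x \<one> \<in> H"
      using sub by (auto simp: Sat_def localization_map_def)
    then obtain a s where a: "a \<in> I" "s \<in> S" "fraction R S x \<one> = fraction R S a s"
      by (auto simp: H_def)
    then obtain u where u: "u \<in> S" "u \<otimes> x \<otimes> s = u \<otimes> a \<otimes> \<one>"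
      using x frac_eq_iff[OF is_cring S, of x \<one> a s] by auto
    \<comment> \<open>The multiplier combines the denominator \<open>s\<close> with the element
      \<open>u\<close> that witnesses the equality of the two fractions.\<close>
    have "(u \<otimes> s) \<otimes> x = u \<otimes> x \<otimes> s" using u a x by (simp add: m_ac)
    also have "\<dots> = u \<otimes> a" using u a by simp
    also have "\<dots> \<in> I" using u a by (simp add: I.I_l_closed)
    finally show "x \<in> {x \<in> carrier R. \<exists>s \<in> S. s \<otimes> x \<in> I}"
      using x u a by (auto intro!: bexI[of _ "u \<otimes> s"])
  next
    fix x assume "x \<in> {x \<in> carrier R. \<exists>s \<in> S. s \<otimes> x \<in> I}"
    then obtain s where x: "x \<in> carrier R" "s \<in> S" "s \<otimes> x \<in> I" by blast
    \<comment> \<open>Here \<open>s\<close> is invertible, so \<open>x/1\<close> is recovered from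
      the image of \<open>s x\<close> by multiplying with \<open>1/s\<close>.\<close>
    have "localization_map R S x = fraction R S \<one> s \<otimes>\<^bsub>?L\<^esub> localization_map R S (s \<otimes> x)"
      using x unfolding localization_map_def
      by (simp add: ops) (intro frac_eqI[OF is_cring S], auto simp: m_comm)
    also have "\<dots> \<in> Idl\<^bsub>?L\<^esub> (localization_map R S ` I)"
      using x L.genideal_self[OF IL] by (intro G.I_l_closed) (auto simp: ops)
    finally show "x \<in> Sat R S I" using x by (simp add: Sat_def)
  qed
qed

lemma (in cring) ideal_Sat:
  assumes S: "submonoid S R" and I: "ideal I R"
  shows "ideal (Sat R S I) R"
proof -
  interpret S: submonoid S R by fact
  interpret I: ideal I R by fact
  show ?thesis unfolding Sat_eq[OF S I]
  proof (rule ideal_of_closed)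
    show "\<zero> \<in> {x \<in> carrier R. \<exists>s\<in>S. s \<otimes> x \<in> I}" by (auto intro: S.one_closed)
    fix x y assume "x \<in> {x \<in> carrier R. \<exists>s\<in>S. s \<otimes> x \<in> I}" "y \<in> {x \<in> carrier R. \<exists>s\<in>S. s \<otimes> x \<in> I}"
    then obtain s t where *: "x \<in> carrier R" "y \<in> carrier R" "s \<in> S" "t \<in> S" "s \<otimes> x \<in> I" "t \<otimes> y \<in> I"
      by blast
    \<comment> \<open>The product of the two multipliers serves both summands.\<close>
    have "(s \<otimes> t) \<otimes> (x \<oplus> y) = t \<otimes> (s \<otimes> x) \<oplus> s \<otimes> (t \<otimes> y)"
      using * by (simp add: r_distr m_ac)
    then have "(s \<otimes> t) \<otimes> (x \<oplus> y) \<in> I" using * by (simp add: I.I_l_closed)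
    then show "x \<oplus> y \<in> {x \<in> carrier R. \<exists>s\<in>S. s \<otimes> x \<in> I}" using * by auto
  next
    fix r x assume "r \<in> carrier R" "x \<in> {x \<in> carrier R. \<exists>s\<in>S. s \<otimes> x \<in> I}"
    then obtain s where *: "r \<in> carrier R" "x \<in> carrier R" "s \<in> S" "s \<otimes> x \<in> I" by blast
    have "s \<otimes> (r \<otimes> x) = r \<otimes> (s \<otimes> x)" using * by (simp add: m_ac)
    then have "s \<otimes> (r \<otimes> x) \<in> I" using * by (simp add: I.I_l_closed)
    then show "r \<otimes> x \<in> {x \<in> carrier R. \<exists>s\<in>S. s \<otimes> x \<in> I}"
      using * by blast
  qed auto
qed

section \<open>Finitely presented ideals\<close>

lemma module_hom_ideal_module_iff:
  "h \<in> module_hom R (free_module R n) (ideal_module R N) \<longleftrightarrow>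
     h \<in> ({..<n} \<rightarrow>\<^sub>E carrier R) \<rightarrow> N \<and>
     (\<forall>v \<in> {..<n} \<rightarrow>\<^sub>E carrier R. \<forall>w \<in> {..<n} \<rightarrow>\<^sub>E carrier R.
        h (\<lambda>i\<in>{..<n}. v i \<oplus>\<^bsub>R\<^esub> w i) = h v \<oplus>\<^bsub>R\<^esub> h w) \<and>
     (\<forall>r \<in> carrier R. \<forall>v \<in> {..<n} \<rightarrow>\<^sub>E carrier R.
        h (\<lambda>i\<in>{..<n}. r \<otimes>\<^bsub>R\<^esub> v i) = r \<otimes>\<^bsub>R\<^esub> h v)"
  by (simp add: module_hom_def hom_def free_module_def)

text \<open>The images of the unit vectors generate \<open>N\<close>. Each is moved into
  \<open>I\<close> by some element of \<open>S\<close>, and the product of these finitely many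
  elements moves all of \<open>N\<close> into \<open>I\<close>.\<close>

lemma (in cring) finitely_presented_ideal_uniform_denominator:
  assumes S: "submonoid S R" and I: "ideal I R" and N: "N \<subseteq> Sat R S I"
    and fp: "finitely_presented R (ideal_module R N)"
  obtains t where "t \<in> S" "\<And>x. x \<in> N \<Longrightarrow> t \<otimes> x \<in> I"
proof -
  interpret S: submonoid S R by fact
  interpret I: ideal I R by fact
  from fp obtain n h where "h \<in> module_hom R (free_module R n) (ideal_module R N)"
    and onto: "h ` ({..<n} \<rightarrow>\<^sub>E carrier R) = N"
    unfolding finitely_presented_def by (auto simp: free_module_def)
  then have h_add: "\<And>v w. v \<in> {..<n} \<rightarrow>\<^sub>E carrier R \<Longrightarrow> w \<in> {..<n} \<rightarrow>\<^sub>E carrier R \<Longrightarrow>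
        h (\<lambda>i\<in>{..<n}. v i \<oplus> w i) = h v \<oplus> h w"
    and h_smult: "\<And>r v. r \<in> carrier R \<Longrightarrow> v \<in> {..<n} \<rightarrow>\<^sub>E carrier R \<Longrightarrow>
        h (\<lambda>i\<in>{..<n}. r \<otimes> v i) = r \<otimes> h v"
    unfolding module_hom_ideal_module_iff by blast+
  have h_Sat: "h v \<in> carrier R \<and> (\<exists>s \<in> S. s \<otimes> h v \<in> I)" if "v \<in> {..<n} \<rightarrow>\<^sub>E carrier R" for v
    using that onto N Sat_eq[OF S I] by blast
  \<comment> \<open>Induction on \<open>k\<close> over vectors supported in the first
    \<open>k\<close> coordinates; \<open>k\<close> may exceed \<open>n\<close>, where nothing new
    happens.\<close>
  have "\<exists>t \<in> S. \<forall>v \<in> {..<n} \<rightarrow>\<^sub>E carrier R. (\<forall>i \<in> {k..<n}. v i = \<zero>) \<longrightarrow> t \<otimes> h v \<in> I" for k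
  proof (induction k)
    case 0
    have "h v = \<zero>" if v: "v \<in> {..<n} \<rightarrow>\<^sub>E carrier R" and "\<forall>i \<in> {0..<n}. v i = \<zero>" for v
    proof -
      \<comment> \<open>All coordinates of \<open>v\<close> vanish, so \<open>v\<close> is its own
        multiple by zero and linearity gives \<open>h v = \<zero>\<close>.\<close>
      have "(\<lambda>i\<in>{..<n}. \<zero> \<otimes> v i) = v"
        using that by (auto simp: fun_eq_iff PiE_iff extensional_def)
      then show ?thesis using h_smult[OF _ v, of \<zero>] h_Sat[OF v] by simp
    qed
    then have "\<one> \<otimes> h v \<in> I" if "v \<in> {..<n} \<rightarrow>\<^sub>E carrier R" "\<forall>i \<in> {0..<n}. v i = \<zero>" for v
      using that by simp
    then show ?case using S.one_closed by blast
  next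
    case (Suc k)
    then obtain t where t: "t \<in> S"
      "\<And>v. v \<in> {..<n} \<rightarrow>\<^sub>E carrier R \<Longrightarrow> \<forall>i \<in> {k..<n}. v i = \<zero> \<Longrightarrow> t \<otimes> h v \<in> I" by blast
    \<comment> \<open>The unit vector at position \<open>k\<close>, or the zero vector if
      \<open>k\<close> is not below \<open>n\<close>. The new denominator is the old one times an
      \<open>s\<close> that moves \<open>h e\<close> into \<open>I\<close>.\<close>
    define e where "e = (\<lambda>i\<in>{..<n}. if i = k then \<one> else \<zero>)"
    have e: "e \<in> {..<n} \<rightarrow>\<^sub>E carrier R" by (auto simp: e_def)
    obtain s where s: "s \<in> S" "s \<otimes> h e \<in> I" using h_Sat[OF e] by blast
    have "(s \<otimes> t) \<otimes> h v \<in> I"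
      if v: "v \<in> {..<n} \<rightarrow>\<^sub>E carrier R" and vz: "\<forall>i \<in> {Suc k..<n}. v i = \<zero>" for v
    proof (cases "k < n")
      case True
      have vc: "v i \<in> carrier R" if "i < n" for i using v that by auto
      with True have vk: "v k \<in> carrier R" by blast
      \<comment> \<open>Deleting coordinate \<open>k\<close> from \<open>v\<close> leaves a vector
        covered by the induction hypothesis, and \<open>v\<close> is this vector plus
        \<open>v k\<close> times \<open>e\<close>.\<close>
      define w where "w = (\<lambda>i\<in>{..<n}. if i = k then \<zero> else v i)"
      have w: "w \<in> {..<n} \<rightarrow>\<^sub>E carrier R"
        unfolding w_def using vc by (intro restrict_PiE_iff[THEN iffD2] ballI) simp
      have ve: "(\<lambda>i\<in>{..<n}. v k \<otimes> e i) \<in> {..<n} \<rightarrow>\<^sub>E carrier R"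
        using vk PiE_mem[OF e] by (intro restrict_PiE_iff[THEN iffD2] ballI) simp
      have "v i = (\<lambda>i\<in>{..<n}. w i \<oplus> (\<lambda>i\<in>{..<n}. v k \<otimes> e i) i) i" for i
      proof (cases "i < n")
        case True
        then show ?thesis using vk vc by (simp add: w_def e_def)
      next
        case False
        then show ?thesis using PiE_arb[OF v, of i] by simp
      qed
      then have "v = (\<lambda>i\<in>{..<n}. w i \<oplus> (\<lambda>i\<in>{..<n}. v k \<otimes> e i) i)" by (rule ext)
      then have hv: "h v = h w \<oplus> v k \<otimes> h e"
        using h_add[OF w ve] h_smult[OF vk e] by simp
      have "t \<otimes> h w \<in> I" using w vz by (intro t) (auto simp: w_def)
      moreover have "(s \<otimes> t) \<otimes> h v = s \<otimes> (t \<otimes> h w) \<oplus> (t \<otimes> v k) \<otimes> (s \<otimes> h e)"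
        unfolding hv using s t(1) vk h_Sat[OF w] h_Sat[OF e] by (simp add: r_distr m_ac)
      ultimately show ?thesis using s t(1) vk by (simp add: I.I_l_closed)
    next
      case False
      \<comment> \<open>The range \<open>{k..<n}\<close> is empty, so the induction hypothesis
        applies to \<open>v\<close> itself.\<close>
      then have "t \<otimes> h v \<in> I" using v by (intro t) auto
      then show ?thesis using s t(1) h_Sat[OF v] by (simp add: m_assoc I.I_l_closed)
    qed
    then show ?case using s(1) t(1) by (intro bexI[of _ "s \<otimes> t"]) auto
  qed
  \<comment> \<open>At \<open>k = n\<close> the support condition is vacuous.\<close>
  from this[of n] obtain t where "t \<in> S" "\<And>v. v \<in> {..<n} \<rightarrow>\<^sub>E carrier R \<Longrightarrow> t \<otimes> h v \<in> I"
    by auto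
  with onto show ?thesis by (intro that[of t]) auto
qed

text \<open>Multiplication by \<open>t\<close> is injective, so following \<open>h\<close> by it
  gives a surjection onto \<open>t N\<close> with the same kernel as \<open>h\<close>; the same
  presentation serves.\<close>

lemma (in cring) finitely_presented_regular_multiple:
  assumes t: "regular_elt R t" and N: "N \<subseteq> carrier R"
    and fp: "finitely_presented R (ideal_module R N)"
  shows "finitely_presented R (ideal_module R ((\<otimes>) t ` N))"
proof -
  from fp obtain n h where h: "h \<in> module_hom R (free_module R n) (ideal_module R N)"
    and onto: "h ` carrier (free_module R n) = N"
    and ker: "finitely_generated R ((free_module R n)
      \<lparr>carrier := a_kernel (free_module R n) (ideal_module R N) h\<rparr>)"
    unfolding finitely_presented_def by auto
  have tc: "t \<in> carrier R" and tr: "\<And>y. y \<in> carrier R \<Longrightarrow> t \<otimes> y = \<zero> \<Longrightarrow> y = \<zero>"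
    using t by (auto simp: regular_elt_def)
  have hc: "h v \<in> carrier R" if "v \<in> {..<n} \<rightarrow>\<^sub>E carrier R" for v
    using h N that by (auto simp: module_hom_ideal_module_iff)
  let ?g = "\<lambda>v. t \<otimes> h v"
  have "?g \<in> module_hom R (free_module R n) (ideal_module R ((\<otimes>) t ` N))"
    using h hc tc unfolding module_hom_ideal_module_iff by (auto simp: r_distr m_lcomm)
  moreover have "?g ` carrier (free_module R n) = (\<otimes>) t ` N"
    using onto by (auto simp: image_image)
  moreover have "a_kernel (free_module R n) (ideal_module R ((\<otimes>) t ` N)) ?g =
      a_kernel (free_module R n) (ideal_module R N) h"
    using hc tr tc by (auto simp: a_kernel_def kernel_def free_module_def)
  ultimately show ?thesis using ker unfolding finitely_presented_def ideal_module_simps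
    by (intro exI[of _ n] bexI[of _ ?g]) simp_all
qed

section \<open>Finiteness conditions in terms of subideals\<close>

lemma (in cring) c_S_finitely_presented_ideal_iff:
  assumes "ideal J R"
  shows "c_S_finitely_presented R S (ideal_module R J) \<longleftrightarrow>
    (\<exists>N. \<exists>s \<in> S. ideal N R \<and> N \<subseteq> J \<and> finitely_presented R (ideal_module R N) \<and>
       (\<forall>x \<in> J. s \<otimes> x \<in> N))"
  by (auto simp: c_S_finitely_presented_def submodule_ideal_module_iff[OF assms] image_subset_iff)

lemma (in cring) S_finite_ideal_iff:
  assumes "ideal J R"
  shows "S_finite R S (ideal_module R J) \<longleftrightarrow>
    (\<exists>N. \<exists>s \<in> S. ideal N R \<and> N \<subseteq> J \<and> fg_ideal R N \<and> (\<forall>x \<in> J. s \<otimes> x \<in> N))"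
  by (simp add: S_finite_def submodule_ideal_module_iff[OF assms] image_subset_iff)
    (metis finitely_generated_ideal_module_iff)

lemma (in cring) fg_ideal_imp_ideal: "fg_ideal R I \<Longrightarrow> ideal I R"
  by (auto simp: fg_ideal_def genideal_ideal)

text \<open>Makes \<open>t N\<close> eligible as the finitely presented subideal in the proof of
  coherence.\<close>

lemma (in cring) ideal_image_mult:
  assumes N: "ideal N R" and t: "t \<in> carrier R"
  shows "ideal ((\<otimes>) t ` N) R"
proof -
  interpret N: ideal N R by fact
  show ?thesis
  proof (rule ideal_of_closed)
    show "\<zero> \<in> (\<otimes>) t ` N" using t by (auto intro!: image_eqI[of _ _ \<zero>])
    show "x \<oplus> y \<in> (\<otimes>) t ` N" if "x \<in> (\<otimes>) t ` N" "y \<in> (\<otimes>) t ` N" for x y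
      using that t by (auto simp: r_distr[symmetric])
    show "r \<otimes> x \<in> (\<otimes>) t ` N" if "r \<in> carrier R" "x \<in> (\<otimes>) t ` N" for r x
      using that t by (auto simp: m_lcomm[of r t] N.I_l_closed)
  qed (use t in auto)
qed

section \<open>The equivalence\<close>

theorem corollary4p10:
  fixes R :: "('a, 'm) ring_scheme" and S :: "'a set"
  assumes "cring R"
    and "submonoid S R"
    and "\<And>s. s \<in> S \<Longrightarrow> regular_elt R s"
  shows "(\<forall>I. fg_ideal R I \<longrightarrow> c_S_finitely_presented R S (ideal_module R (Sat R S I)))
     \<longleftrightarrow>
     (c_S_coherent R S \<and>
      (\<forall>I. fg_ideal R I \<longrightarrow> (\<exists>s \<in> S. Sat R S I = ideal_colon R I s)))"
proof -
  interpret cring R by fact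
  interpret S: submonoid S R by fact
  note Sat = Sat_eq[OF assms(2)] and Sat_ideal = ideal_Sat[OF assms(2)]
  show ?thesis
  proof (intro iffI conjI allI impI)
    assume sat: "\<forall>I. fg_ideal R I \<longrightarrow> c_S_finitely_presented R S (ideal_module R (Sat R S I))"
    \<comment> \<open>Both conclusions of this direction rest on a finitely presented
      \<open>N\<close> between: \<open>s\<close> carries the saturation into \<open>N\<close>, and
      one \<open>t\<close> carries \<open>N\<close> into \<open>I\<close>.\<close>
    have key: "\<exists>N. \<exists>s \<in> S. \<exists>t \<in> S. ideal N R \<and> finitely_presented R (ideal_module R N) \<and>
        (\<forall>x \<in> Sat R S I. s \<otimes>\<^bsub>R\<^esub> x \<in> N) \<and> (\<forall>x \<in> N. t \<otimes>\<^bsub>R\<^esub> x \<in> I)" if I: "fg_ideal R I" for I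
    proof -
      note iI = fg_ideal_imp_ideal[OF I]
      obtain N s where N: "s \<in> S" "ideal N R" "N \<subseteq> Sat R S I"
        "finitely_presented R (ideal_module R N)" "\<forall>x \<in> Sat R S I. s \<otimes>\<^bsub>R\<^esub> x \<in> N"
        using sat I c_S_finitely_presented_ideal_iff[OF Sat_ideal[OF iI]] by blast
      obtain t where "t \<in> S" "\<And>x. x \<in> N \<Longrightarrow> t \<otimes>\<^bsub>R\<^esub> x \<in> I"
        using finitely_presented_ideal_uniform_denominator[OF assms(2) iI N(3,4)] by blast
      with N show ?thesis by blast
    qed
    show "\<exists>s \<in> S. Sat R S I = ideal_colon R I s" if I: "fg_ideal R I" for I
    proof -
      note iI = fg_ideal_imp_ideal[OF I]
      obtain N s t where *: "s \<in> S" "t \<in> S" "\<forall>x \<in> Sat R S I. s \<otimes>\<^bsub>R\<^esub> x \<in> N"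
        "\<forall>x \<in> N. t \<otimes>\<^bsub>R\<^esub> x \<in> I" using key[OF I] by blast
      \<comment> \<open>The colon element is \<open>t s\<close>: first \<open>s\<close> leads into
        \<open>N\<close>, then \<open>t\<close> into \<open>I\<close>. The reverse inclusion holds
        for any element of \<open>S\<close>.\<close>
      have "x \<otimes>\<^bsub>R\<^esub> (t \<otimes>\<^bsub>R\<^esub> s) \<in> I" if "x \<in> Sat R S I" for x
      proof -
        have "x \<in> carrier R" using that Sat[OF iI] by blast
        then have "x \<otimes>\<^bsub>R\<^esub> (t \<otimes>\<^bsub>R\<^esub> s) = t \<otimes>\<^bsub>R\<^esub> (s \<otimes>\<^bsub>R\<^esub> x)" using * by (simp add: m_ac)
        then show ?thesis using * that by simp
      qed
      moreover have ts: "t \<otimes>\<^bsub>R\<^esub> s \<in> S" using * by simp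
      then have "x \<in> Sat R S I" if "x \<in> carrier R" "x \<otimes>\<^bsub>R\<^esub> (t \<otimes>\<^bsub>R\<^esub> s) \<in> I" for x
        using that m_comm[of x "t \<otimes>\<^bsub>R\<^esub> s"] Sat[OF iI] by auto
      ultimately have "Sat R S I = ideal_colon R I (t \<otimes>\<^bsub>R\<^esub> s)"
        using Sat[OF iI] unfolding ideal_colon_def by blast
      with ts show ?thesis by blast
    qed
    show "c_S_coherent R S"
      unfolding c_S_coherent_def
    proof (intro allI impI, elim conjE)
      fix J assume J: "ideal J R" "S_finite R S (ideal_module R J)"
      then obtain I u where I: "u \<in> S" "ideal I R" "I \<subseteq> J" "fg_ideal R I" "\<forall>x \<in> J. u \<otimes>\<^bsub>R\<^esub> x \<in> I"
        using S_finite_ideal_iff by blast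
      obtain N s t where *: "s \<in> S" "t \<in> S" "ideal N R" "finitely_presented R (ideal_module R N)"
        "\<forall>x \<in> Sat R S I. s \<otimes>\<^bsub>R\<^esub> x \<in> N" "\<forall>x \<in> N. t \<otimes>\<^bsub>R\<^esub> x \<in> I" using key[OF I(4)] by blast
      have Jc: "J \<subseteq> carrier R" and Nc: "N \<subseteq> carrier R"
        using J(1) *(3) by (simp_all add: ideal.Icarr subsetI)
      \<comment> \<open>The single multiplier \<open>u\<close> from \<open>S\<close>-finiteness
        places every element of \<open>J\<close> in the saturation of \<open>I\<close>.\<close>
      have JS: "J \<subseteq> Sat R S I" using I Jc Sat[OF I(2)] by blast
      \<comment> \<open>\<open>N\<close> itself need not lie in \<open>J\<close>, but
        \<open>t N\<close> lies in \<open>I\<close> and hence in \<open>J\<close>; the multiplier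
        for \<open>J\<close> becomes \<open>t s\<close>.\<close>
      have "t \<otimes>\<^bsub>R\<^esub> s \<otimes>\<^bsub>R\<^esub> x \<in> (\<otimes>\<^bsub>R\<^esub>) t ` N" if "x \<in> J" for x
      proof -
        have "t \<otimes>\<^bsub>R\<^esub> s \<otimes>\<^bsub>R\<^esub> x = t \<otimes>\<^bsub>R\<^esub> (s \<otimes>\<^bsub>R\<^esub> x)" using that Jc * by (auto simp: m_assoc)
        then show ?thesis using that JS * by auto
      qed
      moreover have "ideal ((\<otimes>\<^bsub>R\<^esub>) t ` N) R" using * by (simp add: ideal_image_mult)
      moreover have "(\<otimes>\<^bsub>R\<^esub>) t ` N \<subseteq> J" using * I by blast
      moreover have "finitely_presented R (ideal_module R ((\<otimes>\<^bsub>R\<^esub>) t ` N))"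
        using finitely_presented_regular_multiple[OF assms(3) Nc] * by blast
      moreover have "t \<otimes>\<^bsub>R\<^esub> s \<in> S" using * by simp
      ultimately show "c_S_finitely_presented R S (ideal_module R J)"
        using c_S_finitely_presented_ideal_iff[OF J(1)] by blast
    qed
  next
    fix I assume *: "c_S_coherent R S \<and>
      (\<forall>I. fg_ideal R I \<longrightarrow> (\<exists>s \<in> S. Sat R S I = ideal_colon R I s))" and I: "fg_ideal R I"
    note iI = fg_ideal_imp_ideal[OF I]
    interpret I: ideal I R by (rule iI)
    obtain s where s: "s \<in> S" "Sat R S I = ideal_colon R I s" using * I by blast
    \<comment> \<open>The colon equality gives one multiplier for the whole saturation, so
      \<open>I\<close> is the finitely generated subideal that makes it \<open>S\<close>-finite, and
      coherence applies.\<close>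
    have "\<forall>x \<in> Sat R S I. s \<otimes>\<^bsub>R\<^esub> x \<in> I"
      using s(1) unfolding s(2) ideal_colon_def by (auto simp: m_comm)
    moreover have "I \<subseteq> Sat R S I"
      using s(1) unfolding s(2) ideal_colon_def by (auto simp: I.I_r_closed)
    ultimately have "S_finite R S (ideal_module R (Sat R S I))"
      using S_finite_ideal_iff[OF Sat_ideal[OF iI]] I iI s(1) by blast
    then show "c_S_finitely_presented R S (ideal_module R (Sat R S I))"
      using * Sat_ideal[OF iI] unfolding c_S_coherent_def by blast
  qed
qed

end
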